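(* Let $X$ be a Banach space and let $\{\varphi_t : X\to X \mid t\ge 0\}$ be a semigroup of continuous linear operators such that for each $v\in X$ the function $t\mapsto \varphi_t(v)$ is continuous for $t>0$. Let $X_0=\{x\in X\mid \varphi_t(x)\to 0 \text{ as } t\to\infty\}$ and suppose that $\operatorname{codim} X_0=n<\infty$ and that the semigroup $\varphi_t$ is slowly increasing. Let $Y\subset X$ be an $n$-dimensional subspace such that $X_0\oplus Y=X$, and write $Y_t=\varphi_t(Y)$. Then $Y$ is almost stabilizable; i.e., for each $t<\infty$, $$\sup_{0\le s<t}\angle(Y_T,Y_{T+s})\to 0\quad\text{as } T\to\infty .$$
   Context: A semigroup means $\varphi_t\circ\varphi_q=\varphi_{t+q}$ for all $t,q\ge 0$. When $\operatorname{codim}X_0=n<\infty$ and $X=X_0\oplus Y$ with $\dim Y=n$, the invariance $\varphi_t(X_0)\subset X_0$ gives a decomposition $$\varphi_t=\begin{pmatrix}\alpha_t & b_t\\ 0& Q_t\end{pmatrix}:X_0\times Y\to X_0\times Y,$$ where $Q_t:Y\to Y$ is a semigroup. The semigroup $\varphi_t$ is called slowly increasing if the semigroup $Q_t$ is bounded, i.e. $\sup_{t\ge 0}\|Q_t\|<\infty$; this condition does not depend on the choice of the complement $Y$. For subspaces $A,B\subset X$ the angle is $$\angle(A,B)=\min\Bigl\{\sup_{a\in A,\,|a|=1}\rho(a,B),\ \sup_{b\in B,\,|b|=1}\rho(b,A)\Bigr\},$$ where $\rho(v,A)$ denotes the distance from the vector $v$ to the subspace $A$. *)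

theory Defs
  imports "HOL-Analysis.Analysis"
begin

text \<open>
  A semigroup is a family of continuous linear operators indexed by the reals \<open>t \<ge> 0\<close>; values at
  negative parameters are irrelevant. The operator at time \<open>0\<close> is not required to be the
  identity.
\<close>

definition operator_semigroup :: "(real \<Rightarrow> 'a::real_normed_vector \<Rightarrow> 'a) \<Rightarrow> bool" where
  "operator_semigroup \<phi> \<longleftrightarrow>
     (\<forall>t\<ge>0. bounded_linear (\<phi> t)) \<and> (\<forall>t\<ge>0. \<forall>q\<ge>0. \<phi> t \<circ> \<phi> q = \<phi> (t + q))"

definition vanishing_subspace :: "(real \<Rightarrow> 'a::real_normed_vector \<Rightarrow> 'a) \<Rightarrow> 'a set" where
  "vanishing_subspace \<phi> = {x. ((\<lambda>t. \<phi> t x) \<longlongrightarrow> 0) at_top}"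

text \<open>
  The library function \<open>dim\<close> is \<open>0\<close> on infinite-dimensional sets, so finite dimension and
  codimension are stated as relations.
\<close>

definition has_dim :: "'a::real_vector set \<Rightarrow> nat \<Rightarrow> bool" where
  "has_dim Y n \<longleftrightarrow> (\<exists>B. finite B \<and> card B = n \<and> independent B \<and> span B = Y)"

text \<open>
  The quotient by \<open>W\<close> has dimension \<open>n\<close>: the classes of the \<open>n\<close> elements of \<open>B\<close> form a basis
  of it.
\<close>

definition has_codim :: "'a::real_vector set \<Rightarrow> nat \<Rightarrow> bool" where
  "has_codim W n \<longleftrightarrow> subspace W \<and>
     (\<exists>B. finite B \<and> card B = n \<and>
        (\<forall>x. \<exists>!c. (\<forall>b. b \<notin> B \<longrightarrow> c b = 0) \<and> x - (\<Sum>b\<in>B. c b *\<^sub>R b) \<in> W))"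

definition complementary :: "'a::real_vector set \<Rightarrow> 'a set \<Rightarrow> bool" where
  "complementary W Y \<longleftrightarrow>
     subspace W \<and> subspace Y \<and> W \<inter> Y = {0} \<and> {w + y | w y. w \<in> W \<and> y \<in> Y} = UNIV"

definition projection_along :: "'a::real_vector set \<Rightarrow> 'a set \<Rightarrow> 'a \<Rightarrow> 'a" where
  "projection_along W Y x = (THE y. y \<in> Y \<and> x - y \<in> W)"

text \<open>
  The lower right block \<open>Q\<^sub>t : Y \<rightarrow> Y\<close> of \<open>\<phi>\<^sub>t\<close> with respect to \<open>X = X\<^sub>0 \<oplus> Y\<close>; it is meaningful
  only on \<open>Y\<close>.
\<close>

definition quotient_block ::
    "(real \<Rightarrow> 'a::real_normed_vector \<Rightarrow> 'a) \<Rightarrow> 'a set \<Rightarrow> real \<Rightarrow> 'a \<Rightarrow> 'a" where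
  "quotient_block \<phi> Y t y = projection_along (vanishing_subspace \<phi>) Y (\<phi> t y)"

text \<open>
  Suprema are taken in \<^typ>\<open>ennreal\<close>, where they always exist and the supremum of the empty set
  is \<open>0\<close>; the latter matters for the zero subspace.
\<close>

definition onorm_on :: "'a::real_normed_vector set \<Rightarrow> ('a \<Rightarrow> 'a) \<Rightarrow> ennreal" where
  "onorm_on Y f = (SUP y\<in>Y. ennreal (norm (f y) / norm y))"

text \<open>
  Boundedness of \<open>Q\<^sub>t\<close> does not depend on the finite-dimensional complement used, so the existential
  quantifier could equally be a universal one when the codimension is finite.
\<close>

definition slowly_increasing :: "(real \<Rightarrow> 'a::real_normed_vector \<Rightarrow> 'a) \<Rightarrow> bool" where
  "slowly_increasing \<phi> \<longleftrightarrow>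
     (\<exists>Y n. has_dim Y n \<and> complementary (vanishing_subspace \<phi>) Y \<and>
        (SUP t\<in>{0..}. onorm_on Y (quotient_block \<phi> Y t)) < \<infinity>)"

definition subspace_angle :: "'a::real_normed_vector set \<Rightarrow> 'a set \<Rightarrow> ennreal" where
  "subspace_angle A B =
     min (SUP a\<in>{a \<in> A. norm a = 1}. ennreal (infdist a B))
         (SUP b\<in>{b \<in> B. norm b = 1}. ennreal (infdist b A))"

definition almost_stabilizable ::
    "(real \<Rightarrow> 'a::real_normed_vector \<Rightarrow> 'a) \<Rightarrow> 'a set \<Rightarrow> bool" where
  "almost_stabilizable \<phi> Y \<longleftrightarrow>
     (\<forall>t::real. ((\<lambda>T. SUP s\<in>{0..<t}. subspace_angle (\<phi> T ` Y) (\<phi> (T + s) ` Y)) \<longlongrightarrow> 0) at_top)"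

end

theory Submission
  imports Defs
begin

text \<open>
  Write \<open>X\<^sub>0\<close> for the vanishing subspace, \<open>P\<close> for the projection onto \<open>Y\<close> along
  \<open>X\<^sub>0\<close>, and \<open>R\<^sub>t = P \<circ> \<phi>\<^sub>t\<close>, which extends the block \<open>Q\<^sub>t\<close> to all of
  \<open>X\<close>. A vector of \<open>Y\<^bsub>T+s\<^esub>\<close> has the form \<open>\<phi>\<^bsub>T+s\<^esub> y\<close> and is to be compared with
  \<open>\<phi>\<^sub>T (Q\<^sub>s y) \<in> Y\<^sub>T\<close>. The difference is \<open>\<phi>\<^sub>T\<close> applied to
  \<open>\<phi>\<^sub>s y - Q\<^sub>s y \<in> X\<^sub>0\<close>, so it tends to \<open>0\<close> for fixed \<open>s\<close> and \<open>y\<close>. The theorem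
  follows once this is uniform in \<open>s\<close> and \<open>y\<close>, and small relative to
  \<open>\<parallel>\<phi>\<^bsub>T+s\<^esub> y\<parallel>\<close>; since the angle is a minimum of two suprema, one of them suffices.

  Uniformity (\<open>almost_commutes_uniformly\<close>). Apart from a factor \<open>\<phi>\<^sub>1\<close>, which moves the
  orbits to positive times, where they are continuous, the vectors
  \<open>\<phi>\<^sub>s b - Q\<^sub>s b\<close> with \<open>b\<close> in a basis of \<open>Y\<close> and \<open>s\<close> in a bounded interval lie in
  a compact subset of \<open>X\<^sub>0\<close>. On compact sets an equibounded family that converges to \<open>0\<close>
  pointwise does so uniformly. Equiboundedness of \<open>\<phi>\<^sub>t\<close> on \<open>X\<^sub>0\<close> for large \<open>t\<close>
  (\<open>X0_equibounded\<close>) is not immediate from the uniform boundedness principle, because nothing says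
  in advance that \<open>X\<^sub>0\<close> is closed; it comes from Baire's theorem in \<open>X\<close> and the finite
  codimension, and closedness of \<open>X\<^sub>0\<close> and continuity of \<open>P\<close> are consequences.

  Lower bound. As \<open>P\<close> is bounded, it suffices that \<open>\<parallel>Q\<^sub>t y\<parallel> \<ge> c \<parallel>y\<parallel>\<close> with
  \<open>c > 0\<close> independent of \<open>t\<close> (\<open>quotient_bounded_below\<close>). By compactness of the unit sphere of
  \<open>Y\<close> and boundedness of \<open>Q\<^sub>t\<close> this can only fail if \<open>Q\<^sub>t y \<rightarrow> 0\<close> for some
  \<open>y \<noteq> 0\<close>. Such \<open>y\<close> form an invariant subspace on which some \<open>Q\<^sub>\<tau>\<close> is a contraction,
  and the uniform estimate then gives
  \<open>\<parallel>\<phi>\<^bsub>T+\<tau>\<^esub> y\<parallel> \<le> \<parallel>\<phi>\<^sub>T (Q\<^sub>\<tau> y)\<parallel> + \<epsilon> \<parallel>y\<parallel>\<close>, whose iteration forces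
  \<open>\<phi>\<^sub>T y \<rightarrow> 0\<close> (\<open>quotient_stable_imp_zero\<close>). So \<open>y \<in> X\<^sub>0 \<inter> Y\<close>, that is, \<open>y = 0\<close>.
\<close>

section \<open>Finite-dimensional subspaces of normed spaces\<close>

text \<open>
  Equivalence of norms on a finite-dimensional space: the sphere of the \<open>\<ell>\<^sup>1\<close>-norm on
  coefficient functions supported in \<open>B\<close> is compact in the product topology, so the norm of the
  linear combination attains its minimum there, and independence makes that minimum positive.
\<close>

lemma finite_independent_coeff_bound:
  fixes B :: "'a::real_normed_vector set"
  assumes "finite B" "independent B"
  obtains c where "c > 0" "\<And>f. c * (\<Sum>b\<in>B. \<bar>f b\<bar>) \<le> norm (\<Sum>b\<in>B. f b *\<^sub>R b)"
proof -
  define C where "C = PiE UNIV (\<lambda>b. if b \<in> B then {-1..1::real} else {0})"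
  define S where "S = C \<inter> {f. (\<Sum>b\<in>B. \<bar>f b\<bar>) = 1}"
  have "compactin (product_topology (\<lambda>i. euclidean) UNIV) C"
    unfolding C_def by (subst compactin_PiE) auto
  then have "compact C"
    by (simp add: euclidean_product_topology)
  moreover have "closed {f :: 'a \<Rightarrow> real. (\<Sum>b\<in>B. \<bar>f b\<bar>) = 1}"
    by (intro closed_Collect_eq continuous_on_sum continuous_on_rabs continuous_on_const
        continuous_on_product_coordinates)
  ultimately have "compact S"
    unfolding S_def by blast
  have cont: "continuous_on S (\<lambda>f. norm (\<Sum>b\<in>B. f b *\<^sub>R b))"
    by (intro continuous_intros continuous_on_product_coordinates[THEN continuous_on_subset]) auto
  obtain c where c: "c > 0" "\<And>f. f \<in> S \<Longrightarrow> c \<le> norm (\<Sum>b\<in>B. f b *\<^sub>R b)"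
  proof (cases "S = {}")
    case False
    then obtain g where g: "g \<in> S" "\<And>f. f \<in> S \<Longrightarrow>
        norm (\<Sum>b\<in>B. g b *\<^sub>R b) \<le> norm (\<Sum>b\<in>B. f b *\<^sub>R b)"
      using continuous_attains_inf[OF \<open>compact S\<close> _ cont] by blast
    have "(\<Sum>b\<in>B. g b *\<^sub>R b) \<noteq> 0"
    proof
      assume "(\<Sum>b\<in>B. g b *\<^sub>R b) = 0"
      then have "\<forall>b\<in>B. g b = 0"
        using assms by (auto simp: dependent_finite)
      then show False
        using g(1) by (simp add: S_def)
    qed
    then show ?thesis
      using g that[of "norm (\<Sum>b\<in>B. g b *\<^sub>R b)"] by simp
  qed (use that[of 1] in auto)
  have "c * (\<Sum>b\<in>B. \<bar>f b\<bar>) \<le> norm (\<Sum>b\<in>B. f b *\<^sub>R b)" for f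
  proof -
    define s where "s = (\<Sum>b\<in>B. \<bar>f b\<bar>)"
    show ?thesis
    proof (cases "s = 0")
      case False
      then have s: "s > 0"
        unfolding s_def by (simp add: sum_nonneg less_le)
      define g where "g b = (if b \<in> B then f b / s else 0)" for b
      have "\<bar>f b\<bar> \<le> s" if "b \<in> B" for b
        unfolding s_def using that assms(1) by (intro member_le_sum) auto
      then have g1: "\<bar>g b\<bar> \<le> 1" if "b \<in> B" for b
        using that s by (simp add: g_def)
      have "g b \<in> (if b \<in> B then {-1..1} else {0})" for b
        using abs_le_D1[OF g1[of b]] abs_le_D2[OF g1[of b]] by (cases "b \<in> B") (auto simp: g_def[of b])
      then have "g \<in> C"
        by (simp add: C_def PiE_iff)
      moreover have "(\<Sum>b\<in>B. \<bar>g b\<bar>) = 1"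
        using s by (simp add: g_def s_def flip: sum_divide_distrib)
      ultimately have "c \<le> norm (\<Sum>b\<in>B. g b *\<^sub>R b)"
        by (intro c(2)) (simp add: S_def)
      also have "(\<Sum>b\<in>B. g b *\<^sub>R b) = (1/s) *\<^sub>R (\<Sum>b\<in>B. f b *\<^sub>R b)"
        by (simp add: g_def scaleR_right.sum divide_inverse mult.commute)
      finally show ?thesis
        using s by (simp add: field_simps flip: s_def)
    qed (simp flip: s_def)
  qed
  with c(1) show ?thesis
    using that by blast
qed

lemma compact_span_cball:
  fixes B :: "'a::real_normed_vector set"
  assumes "finite B" "independent B"
  shows "compact (span B \<inter> cball 0 r)"
proof -
  obtain c where c: "c > 0" "\<And>f. c * (\<Sum>b\<in>B. \<bar>f b\<bar>) \<le> norm (\<Sum>b\<in>B. f b *\<^sub>R b)"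
    using finite_independent_coeff_bound[OF assms] by blast
  define C where "C = PiE UNIV (\<lambda>b. if b \<in> B then {-(r/c)..r/c::real} else {0})"
  have "compactin (product_topology (\<lambda>i. euclidean) UNIV) C"
    unfolding C_def by (subst compactin_PiE) auto
  then have "compact C"
    by (simp add: euclidean_product_topology)
  moreover have "continuous_on C (\<lambda>f. \<Sum>b\<in>B. f b *\<^sub>R b)"
    by (intro continuous_intros continuous_on_product_coordinates[THEN continuous_on_subset]) auto
  ultimately have "compact ((\<lambda>f. \<Sum>b\<in>B. f b *\<^sub>R b) ` C \<inter> cball 0 r)"
    by (intro compact_Int_closed compact_continuous_image) auto
  also have "(\<lambda>f. \<Sum>b\<in>B. f b *\<^sub>R b) ` C \<inter> cball 0 r = span B \<inter> cball 0 r"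
  proof (intro equalityI subsetI)
    fix x assume "x \<in> span B \<inter> cball 0 r"
    then obtain f where x: "x = (\<Sum>b\<in>B. f b *\<^sub>R b)" and r: "norm x \<le> r"
      using span_finite[OF assms(1)] by auto
    define g where "g b = (if b \<in> B then f b else 0)" for b
    have fr: "\<bar>f b\<bar> \<le> r / c" if "b \<in> B" for b
    proof -
      have "\<bar>f b\<bar> \<le> (\<Sum>b\<in>B. \<bar>f b\<bar>)"
        using that assms(1) by (intro member_le_sum) auto
      also have "\<dots> \<le> r / c"
        using c(2)[of f] r c(1) x by (simp add: field_simps)
      finally show ?thesis .
    qed
    have "g \<in> C"
      using fr by (force simp: C_def PiE_iff g_def abs_le_iff)
    moreover have "x = (\<Sum>b\<in>B. g b *\<^sub>R b)"
      by (simp add: g_def x)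
    ultimately show "x \<in> (\<lambda>f. \<Sum>b\<in>B. f b *\<^sub>R b) ` C \<inter> cball 0 r"
      using r by auto
  qed (auto intro!: span_sum span_scale intro: span_base)
  finally show ?thesis .
qed

lemma compact_span_sphere:
  fixes B :: "'a::real_normed_vector set"
  assumes "finite B" "independent B"
  shows "compact (span B \<inter> sphere 0 r)"
proof -
  have "span B \<inter> sphere 0 r = span B \<inter> cball 0 r \<inter> {x. norm x = r}"
    by auto
  then show ?thesis
    by (simp only:) (intro compact_Int_closed compact_span_cball assms closed_Collect_eq
        continuous_on_norm continuous_on_id continuous_on_const)
qed

lemma finite_basis_of_subspace_of_span:
  assumes "finite B" "subspace V" "V \<subseteq> span B"
  obtains B' where "finite B'" "independent B'" "span B' = V"
proof -
  obtain B' where B': "B' \<subseteq> V" "independent B'" "V \<subseteq> span B'"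
    using maximal_independent_subset by blast
  then have "finite B'"
    using independent_span_bound[OF assms(1)] assms(3) by auto
  moreover have "span B' = V"
    using B' assms(2) by (simp add: span_minimal subset_antisym)
  ultimately show ?thesis
    using that B' by blast
qed

text \<open>
  The constant serves all linear maps at once; this is what turns estimates on the finitely many
  vectors of a basis, each holding for large times, into operator estimates.
\<close>

lemma linear_bound_on_span:
  fixes B :: "'a::real_normed_vector set"
  assumes "finite B" "independent B"
  obtains A where "A > 0"
    "\<And>(f :: 'a \<Rightarrow> 'b::real_normed_vector) D y. linear f \<Longrightarrow> D \<ge> 0 \<Longrightarrow>
       (\<And>b. b \<in> B \<Longrightarrow> norm (f b) \<le> D) \<Longrightarrow> y \<in> span B \<Longrightarrow> norm (f y) \<le> A * D * norm y"
proof -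
  obtain c where c: "c > 0" "\<And>f. c * (\<Sum>b\<in>B. \<bar>f b\<bar>) \<le> norm (\<Sum>b\<in>B. f b *\<^sub>R b)"
    using finite_independent_coeff_bound[OF assms] by blast
  have "norm (f y) \<le> 1 / c * D * norm y"
    if f: "linear f" and D: "D \<ge> 0" "\<And>b. b \<in> B \<Longrightarrow> norm (f b) \<le> D" and y: "y \<in> span B"
    for f :: "'a \<Rightarrow> 'b" and D y
  proof -
    obtain u where u: "y = (\<Sum>b\<in>B. u b *\<^sub>R b)"
      using y span_finite[OF assms(1)] by auto
    have "norm (f y) = norm (\<Sum>b\<in>B. u b *\<^sub>R f b)"
      by (simp add: u linear_sum[OF f] linear_scale[OF f])
    also have "\<dots> \<le> (\<Sum>b\<in>B. \<bar>u b\<bar> * D)"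
      by (rule sum_norm_le) (simp add: D mult_left_mono)
    also have "\<dots> = D * (\<Sum>b\<in>B. \<bar>u b\<bar>)"
      by (simp add: sum_distrib_left mult.commute)
    also have "\<dots> \<le> D * (norm y / c)"
      using c(2)[of u] c(1) D(1) by (intro mult_left_mono) (simp_all add: u field_simps)
    finally show ?thesis
      by simp
  qed
  with c(1) show ?thesis
    using that[of "1 / c"] by simp
qed

section \<open>Equibounded families and Baire's theorem\<close>

text \<open>
  The bound is required only on the set itself, so that the lemma can be used to show that the set
  is closed before anything is known about its closure: by continuity the bound passes to
  differences between members of the set and their limits.
\<close>

lemma closed_tendsto_zero_set:
  fixes f :: "real \<Rightarrow> 'a::real_normed_vector \<Rightarrow> 'b::real_normed_vector"
  assumes bl: "\<And>t. t \<ge> N \<Longrightarrow> bounded_linear (f t)"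
    and bound: "\<And>t x. t \<ge> N \<Longrightarrow> ((\<lambda>t. f t x) \<longlongrightarrow> 0) at_top \<Longrightarrow> norm (f t x) \<le> M * norm x"
    and "M > 0"
  shows "closed {x. ((\<lambda>t. f t x) \<longlongrightarrow> 0) at_top}" (is "closed ?V")
proof -
  have "x \<in> ?V" if u: "\<And>n. u n \<in> ?V" and lim: "u \<longlonglongrightarrow> x" for u x
  proof -
    have cb: "norm (f t (u n - x)) \<le> M * norm (u n - x)" if t: "t \<ge> N" for t n
    proof -
      have "((\<lambda>t. f t (u n) - f t (u m)) \<longlongrightarrow> 0) at_top" for m
        using tendsto_diff[of "\<lambda>t. f t (u n)" 0 at_top "\<lambda>t. f t (u m)" 0] u by simp
      moreover have "\<forall>\<^sub>F t in at_top. f t (u n) - f t (u m) = f t (u n - u m)" for m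
        using eventually_ge_at_top[of N]
        by eventually_elim (simp only: linear_diff[OF bounded_linear.linear[OF bl]])
      ultimately have "((\<lambda>t. f t (u n - u m)) \<longlongrightarrow> 0) at_top" for m
        by (rule Lim_transform_eventually)
      then have b: "norm (f t (u n - u m)) \<le> M * norm (u n - u m)" for m
        using bound[OF t] by blast
      have "(\<lambda>m. norm (f t (u n - u m))) \<longlonglongrightarrow> norm (f t (u n - x))"
        by (intro tendsto_norm bounded_linear.tendsto[OF bl[OF t]] tendsto_diff tendsto_const lim)
      moreover have "(\<lambda>m. M * norm (u n - u m)) \<longlonglongrightarrow> M * norm (u n - x)"
        by (intro tendsto_mult_left tendsto_norm tendsto_diff tendsto_const lim)
      ultimately show ?thesis
        by (rule LIMSEQ_le) (use b in auto)
    qed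
    have "\<forall>\<^sub>F t in at_top. dist (f t x) 0 < e" if "e > 0" for e
    proof -
      have "\<forall>\<^sub>F n in sequentially. dist (u n) x < e / 2 / M"
        using lim \<open>e > 0\<close> \<open>M > 0\<close> by (intro tendstoD) auto
      then obtain n where n: "norm (u n - x) < e / 2 / M"
        by (auto simp: eventually_sequentially dist_norm)
      have "\<forall>\<^sub>F t in at_top. dist (f t (u n)) 0 < e / 2"
        using u[of n] \<open>e > 0\<close> by (intro tendstoD) auto
      then show ?thesis
        using eventually_ge_at_top[of N]
      proof eventually_elim
        case (elim t)
        have "norm (f t x) = norm (f t (u n) - f t (u n - x))"
          by (simp add: linear_diff[OF bounded_linear.linear[OF bl[OF elim(2)]]])
        also have "\<dots> \<le> norm (f t (u n)) + M * norm (u n - x)"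
          using cb[OF elim(2), of n] norm_triangle_ineq4[of "f t (u n)" "f t (u n - x)"] by linarith
        also have "norm (f t (u n)) < e / 2"
          using elim(1) by simp
        also have "M * norm (u n - x) < e / 2"
          using n \<open>M > 0\<close> by (simp add: field_simps)
        finally show ?case
          by simp
      qed
    qed
    then show ?thesis
      by (intro CollectI tendstoI)
  qed
  then show ?thesis
    unfolding closed_sequential_limits by blast
qed

lemma equibounded_tendsto_zero_uniform_on_compact:
  fixes f :: "real \<Rightarrow> 'a::real_normed_vector \<Rightarrow> 'b::real_normed_vector"
  assumes lin: "\<And>t. t \<ge> N \<Longrightarrow> linear (f t)"
    and bound: "\<And>t x. t \<ge> N \<Longrightarrow> x \<in> V \<Longrightarrow> norm (f t x) \<le> M * norm x"
    and "M > 0" "subspace V" "C \<subseteq> V" "compact C"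
    and lim: "\<And>x. x \<in> C \<Longrightarrow> ((\<lambda>t. f t x) \<longlongrightarrow> 0) at_top"
    and "e > 0"
  shows "\<forall>\<^sub>F t in at_top. \<forall>x\<in>C. norm (f t x) \<le> e"
proof -
  have "C \<subseteq> (\<Union>x\<in>C. ball x (e/2/M))"
    using \<open>e > 0\<close> \<open>M > 0\<close> by auto
  then obtain k where k: "finite k" "k \<subseteq> C" "C \<subseteq> (\<Union>x\<in>k. ball x (e/2/M))"
    by (rule compactE_image[OF \<open>compact C\<close>, rotated]) auto
  have "\<forall>\<^sub>F t in at_top. \<forall>x\<in>k. dist (f t x) 0 < e / 2"
    using k lim \<open>e > 0\<close> by (intro eventually_ball_finite ballI tendstoD) auto
  then show ?thesis
    using eventually_ge_at_top[of N]
  proof eventually_elim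
    case (elim t)
    show ?case
    proof
      fix x assume x: "x \<in> C"
      then obtain z where z: "z \<in> k" "dist z x < e/2/M"
        using k by auto
      have V: "x - z \<in> V"
        using x z(1) k(2) \<open>C \<subseteq> V\<close> \<open>subspace V\<close> by (auto intro!: subspace_diff)
      have "norm (f t x) = norm (f t z + f t (x - z))"
        by (simp add: linear_diff[OF lin[OF elim(2)]])
      also have "\<dots> \<le> norm (f t z) + M * norm (x - z)"
        using norm_triangle_ineq[of "f t z" "f t (x - z)"] bound[OF elim(2) V] by linarith
      also have "norm (f t z) \<le> e / 2"
        using elim(1) z(1) by force
      also have "M * norm (x - z) \<le> e / 2"
        using z(2) \<open>M > 0\<close> by (simp add: field_simps dist_norm norm_minus_commute)
      finally show "norm (f t x) \<le> e"
        by simp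
    qed
  qed
qed

lemma Baire_closed_cover:
  fixes F :: "nat \<Rightarrow> 'a::{complete_space} set"
  assumes "\<And>n. closed (F n)" "(\<Union>n. F n) = UNIV"
  obtains n x d where "d > 0" "ball x d \<subseteq> F n"
proof -
  have "\<exists>n. interior (F n) \<noteq> {}"
  proof (rule ccontr)
    assume "\<nexists>n. interior (F n) \<noteq> {}"
    then have "euclidean interior_of \<Union>(range F) = {}"
      using assms by (intro Baire_category_alt disjI1 completely_metrizable_space_euclidean) auto
    then show False
      using assms(2) by simp
  qed
  then show ?thesis
    using that by (meson all_not_in_conv mem_interior)
qed

section \<open>Equiboundedness on the vanishing subspace\<close>

text \<open>
  The complement is presented by a basis \<open>B\<close>, which is what the compactness arguments use.
\<close>

locale complemented_semigroup =
  fixes \<phi> :: "real \<Rightarrow> 'a::banach \<Rightarrow> 'a" and B :: "'a set"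
  assumes semigroup: "operator_semigroup \<phi>"
    and fin: "finite B" and indep: "independent B"
    and compl: "complementary (vanishing_subspace \<phi>) (span B)"
begin

abbreviation X0 where "X0 \<equiv> vanishing_subspace \<phi>"
abbreviation P where "P \<equiv> projection_along X0 (span B)"

lemma bounded_linear_\<phi>: "t \<ge> 0 \<Longrightarrow> bounded_linear (\<phi> t)"
  using semigroup by (auto simp: operator_semigroup_def)

lemma linear_\<phi>: "t \<ge> 0 \<Longrightarrow> linear (\<phi> t)"
  by (rule bounded_linear.linear[OF bounded_linear_\<phi>])

lemma \<phi>_compose: "t \<ge> 0 \<Longrightarrow> q \<ge> 0 \<Longrightarrow> \<phi> t (\<phi> q x) = \<phi> (t + q) x"
  using semigroup by (auto simp: operator_semigroup_def fun_eq_iff)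

lemma subspace_X0: "subspace X0"
  using compl by (simp add: complementary_def)

lemma X0_Int_span: "x \<in> X0 \<Longrightarrow> x \<in> span B \<Longrightarrow> x = 0"
  using compl by (auto simp: complementary_def)

lemma X0_D: "x \<in> X0 \<Longrightarrow> ((\<lambda>t. \<phi> t x) \<longlongrightarrow> 0) at_top"
  by (simp add: vanishing_subspace_def)

lemma X0_invariant:
  assumes "x \<in> X0" "q \<ge> 0"
  shows "\<phi> q x \<in> X0"
proof -
  have "((\<lambda>t. \<phi> q (\<phi> t x)) \<longlongrightarrow> 0) at_top"
    by (rule bounded_linear.tendsto_zero[OF bounded_linear_\<phi>[OF assms(2)] X0_D[OF assms(1)]])
  moreover have "\<forall>\<^sub>F t in at_top. \<phi> q (\<phi> t x) = \<phi> t (\<phi> q x)"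
    using eventually_ge_at_top[of 0] by eventually_elim (simp add: \<phi>_compose assms add.commute)
  ultimately have "((\<lambda>t. \<phi> t (\<phi> q x)) \<longlongrightarrow> 0) at_top"
    by (rule Lim_transform_eventually)
  then show ?thesis
    by (simp add: vanishing_subspace_def)
qed

lemma P_unique:
  assumes "y \<in> span B" "x - y \<in> X0"
  shows "P x = y"
  unfolding projection_along_def
proof (rule the_equality)
  fix z assume z: "z \<in> span B \<and> x - z \<in> X0"
  have "z - y \<in> X0"
    using subspace_diff[OF subspace_X0 assms(2) conjunct2[OF z]] by simp
  moreover have "z - y \<in> span B"
    using assms z by (simp add: span_diff)
  ultimately show "z = y"
    using X0_Int_span by fastforce
qed (use assms in auto)

lemma P_in_span: "P x \<in> span B" and diff_P_in_X0: "x - P x \<in> X0"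
proof -
  have "x \<in> {w + y |w y. w \<in> X0 \<and> y \<in> span B}"
    using compl by (simp add: complementary_def)
  then obtain w y where "x = w + y" "w \<in> X0" "y \<in> span B"
    by blast
  then have "y \<in> span B" "x - y \<in> X0"
    by simp_all
  moreover from this have "P x = y"
    by (rule P_unique)
  ultimately show "P x \<in> span B" "x - P x \<in> X0"
    by simp_all
qed

lemma P_cong:
  assumes "x - y \<in> X0"
  shows "P x = P y"
proof (rule P_unique)
  have "(x - y) + (y - P y) \<in> X0"
    using assms diff_P_in_X0 subspace_X0 by (intro subspace_add) auto
  then show "x - P y \<in> X0"
    by simp
qed (rule P_in_span)

lemma linear_P: "linear P"
proof (rule linearI)
  fix x y :: 'a and r :: real
  have "(x - P x) + (y - P y) \<in> X0"
    by (intro subspace_add subspace_X0 diff_P_in_X0)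
  then show "P (x + y) = P x + P y"
    by (intro P_unique span_add P_in_span) (simp add: algebra_simps)
  have "r *\<^sub>R (x - P x) \<in> X0"
    by (intro subspace_scale subspace_X0 diff_P_in_X0)
  then show "P (r *\<^sub>R x) = r *\<^sub>R P x"
    by (intro P_unique span_scale P_in_span) (simp add: algebra_simps)
qed

lemma P_\<phi>_P: "t \<ge> 0 \<Longrightarrow> P (\<phi> t (P x)) = P (\<phi> t x)"
  using X0_invariant[OF diff_P_in_X0, of t x]
  by (intro P_cong[symmetric]) (simp add: linear_diff[OF linear_\<phi>])

text \<open>
  The closed sets \<open>F\<^sub>k\<close> of vectors whose orbits are bounded by \<open>k\<close> after time \<open>k\<close> cover
  \<open>X\<^sub>0\<close>; adding the compact ball of radius \<open>k\<close> in the complement gives closed sets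
  \<open>G\<^sub>k\<close> covering \<open>X\<close>, so some \<open>G\<^sub>k\<close> contains a ball. Hence a small \<open>x \<in> X\<^sub>0\<close> is
  \<open>u + y\<close> with a controlled orbit of \<open>u\<close> and \<open>y\<close> in a bounded part of the complement. The
  orbit of \<open>y = x - u\<close> is eventually bounded, and the vectors of the complement with this property
  form a finite-dimensional space \<open>V\<close>, on which pointwise bounds are automatically uniform.
\<close>

lemma X0_equibounded:
  obtains M N where "M > 0" "N \<ge> 0"
    "\<And>t x. t \<ge> N \<Longrightarrow> x \<in> X0 \<Longrightarrow> norm (\<phi> t x) \<le> M * norm x"
proof -
  define F where "F k = (\<Inter>t\<in>{real k..}. {x. norm (\<phi> t x) \<le> real k})" for k
  define G where "G k = (\<Union>x\<in>F k. \<Union>y\<in>span B \<inter> cball 0 (real k). {x + y})" for k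
  have "closed (F k)" for k
    unfolding F_def
    by (intro closed_INT ballI closed_Collect_le continuous_on_norm continuous_on_const
        linear_continuous_on bounded_linear_\<phi>) auto
  then have "closed (G k)" for k
    unfolding G_def by (intro closed_compact_sums compact_span_cball fin indep)
  moreover have "(\<Union>k. G k) = UNIV"
  proof (intro equalityI subsetI UNIV_I)
    fix x :: 'a
    have "\<forall>\<^sub>F t in at_top. dist (\<phi> t (x - P x)) 0 < 1"
      by (intro tendstoD X0_D diff_P_in_X0) auto
    then obtain N where N: "\<And>t. t \<ge> N \<Longrightarrow> norm (\<phi> t (x - P x)) < 1"
      by (auto simp: eventually_at_top_linorder)
    obtain k where k: "max N (max 1 (norm (P x))) \<le> real k"
      using real_arch_simple by blast
    have "norm (\<phi> t (x - P x)) \<le> real k" if "t \<ge> real k" for t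
      using N[of t] that k by simp
    then have "x - P x \<in> F k"
      by (simp add: F_def)
    moreover have "P x \<in> span B \<inter> cball 0 (real k)"
      using k by (simp add: P_in_span)
    moreover have "x = (x - P x) + P x"
      by simp
    ultimately have "x \<in> G k"
      unfolding G_def by blast
    then show "x \<in> (\<Union>k. G k)"
      by blast
  qed
  ultimately obtain k a d where d: "d > 0" "ball a d \<subseteq> G k"
    by (rule Baire_closed_cover)

  define V where "V = {y \<in> span B. \<exists>C. \<forall>\<^sub>F t in at_top. norm (\<phi> t y) \<le> C}"
  have "subspace V"
    unfolding subspace_def
  proof (intro conjI ballI allI)
    have "\<forall>\<^sub>F t in at_top. norm (\<phi> t 0) \<le> 0"
      using eventually_ge_at_top[of 0] by eventually_elim (simp add: linear_0[OF linear_\<phi>])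
    then show "0 \<in> V"
      unfolding V_def using span_zero by blast
  next
    fix x y assume "x \<in> V" "y \<in> V"
    then obtain C D where C: "\<forall>\<^sub>F t in at_top. norm (\<phi> t x) \<le> C"
      and D: "\<forall>\<^sub>F t in at_top. norm (\<phi> t y) \<le> D" and xy: "x \<in> span B" "y \<in> span B"
      by (auto simp: V_def)
    have "\<forall>\<^sub>F t in at_top. norm (\<phi> t (x + y)) \<le> C + D"
      using C D eventually_ge_at_top[of 0]
      by eventually_elim (simp add: linear_add[OF linear_\<phi>] norm_triangle_mono)
    then show "x + y \<in> V"
      using xy by (auto simp: V_def span_add)
  next
    fix x and r :: real assume "x \<in> V"
    then obtain C where C: "\<forall>\<^sub>F t in at_top. norm (\<phi> t x) \<le> C" and x: "x \<in> span B"
      by (auto simp: V_def)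
    have "\<forall>\<^sub>F t in at_top. norm (\<phi> t (r *\<^sub>R x)) \<le> \<bar>r\<bar> * C"
      using C eventually_ge_at_top[of 0]
      by eventually_elim (simp add: linear_scale[OF linear_\<phi>] mult_left_mono)
    then show "r *\<^sub>R x \<in> V"
      using x by (auto simp: V_def span_scale)
  qed
  then obtain B' where B': "finite B'" "independent B'" "span B' = V"
    using finite_basis_of_subspace_of_span[OF fin] by (metis (no_types, lifting) V_def mem_Collect_eq subsetI)
  obtain A where A: "A > 0" "\<And>(f :: 'a \<Rightarrow> 'a) D y. linear f \<Longrightarrow> D \<ge> 0 \<Longrightarrow>
       (\<And>b. b \<in> B' \<Longrightarrow> norm (f b) \<le> D) \<Longrightarrow> y \<in> span B' \<Longrightarrow> norm (f y) \<le> A * D * norm y"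
    using linear_bound_on_span[OF B'(1,2)] by metis
  have "\<forall>b\<in>B'. \<exists>C. \<forall>\<^sub>F t in at_top. norm (\<phi> t b) \<le> C"
  proof
    fix b assume "b \<in> B'"
    then have "b \<in> V"
      using B'(3) span_base by blast
    then show "\<exists>C. \<forall>\<^sub>F t in at_top. norm (\<phi> t b) \<le> C"
      by (simp add: V_def)
  qed
  then obtain C where C: "\<And>b. b \<in> B' \<Longrightarrow> \<forall>\<^sub>F t in at_top. norm (\<phi> t b) \<le> C b"
    by metis
  define D where "D = (\<Sum>b\<in>B'. \<bar>C b\<bar>)"
  have D: "D \<ge> 0"
    by (simp add: D_def sum_nonneg)
  have "\<forall>\<^sub>F t in at_top. \<forall>b\<in>B'. norm (\<phi> t b) \<le> C b"
    using C B'(1) by (intro eventually_ball_finite) auto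
  then obtain N where N: "\<And>t b. t \<ge> N \<Longrightarrow> b \<in> B' \<Longrightarrow> norm (\<phi> t b) \<le> C b"
    by (auto simp: eventually_at_top_linorder)
  define N' where "N' = max N (real k)"
  have V_bound: "norm (\<phi> t y) \<le> A * D * norm y" if "t \<ge> N'" "y \<in> V" for t y
  proof (rule A(2))
    show "linear (\<phi> t)"
      using that by (intro linear_\<phi>) (simp add: N'_def)
    fix b assume b: "b \<in> B'"
    have "norm (\<phi> t b) \<le> \<bar>C b\<bar>"
      using N[OF _ b, of t] that by (simp add: N'_def)
    also have "\<dots> \<le> D"
      unfolding D_def using b B'(1) by (intro member_le_sum) auto
    finally show "norm (\<phi> t b) \<le> D" .
  qed (use that D B'(3) in auto)

  define L where "L = 2 * real k + A * D * (2 * real k)"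
  have L: "L \<ge> 0"
    using A(1) D by (simp add: L_def)
  have small: "norm (\<phi> t x) \<le> L" if t: "t \<ge> N'" and x: "x \<in> X0" "norm x < d" for t x
  proof -
    \<comment> \<open>Subtracting the decomposition of the centre \<open>a\<close> moves the ball to the origin at the cost
      of doubling the constants.\<close>
    have "a + x \<in> G k" "a \<in> G k"
      using d x(2) by (auto simp: dist_norm intro!: subsetD[OF d(2)])
    then obtain u1 y1 u2 y2 where u: "u1 \<in> F k" "u2 \<in> F k"
      and y: "y1 \<in> span B" "y2 \<in> span B" "norm y1 \<le> real k" "norm y2 \<le> real k"
      and eq: "a + x = u1 + y1" "a = u2 + y2"
      unfolding G_def by auto
    define y where "y = y1 - y2"
    define u where "u = u1 - u2"
    have xu: "x = u + y"
      using eq by (simp add: u_def y_def algebra_simps)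
    have u_bound: "norm (\<phi> t u) \<le> 2 * real k" if "t \<ge> real k" for t
    proof -
      have "norm (\<phi> t u1) \<le> real k" "norm (\<phi> t u2) \<le> real k"
        using u that by (auto simp: F_def)
      moreover have "norm (\<phi> t u) \<le> norm (\<phi> t u1) + norm (\<phi> t u2)"
        using that by (simp add: u_def linear_diff[OF linear_\<phi>] norm_triangle_ineq4)
      ultimately show ?thesis
        by linarith
    qed
    have "\<forall>\<^sub>F t in at_top. dist (\<phi> t x) 0 < 1"
      by (intro tendstoD X0_D x) auto
    then have "\<forall>\<^sub>F t in at_top. norm (\<phi> t y) \<le> 1 + 2 * real k"
      using eventually_ge_at_top[of "real k"]
    proof eventually_elim
      case (elim t)
      have "norm (\<phi> t y) = norm (\<phi> t x - \<phi> t u)"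
        using elim(2) by (simp add: xu linear_add[OF linear_\<phi>])
      also have "\<dots> \<le> norm (\<phi> t x) + norm (\<phi> t u)"
        by (rule norm_triangle_ineq4)
      also have "\<dots> \<le> 1 + 2 * real k"
        using elim u_bound[of t] by simp
      finally show ?case .
    qed
    moreover have "y \<in> span B"
      using y by (simp add: y_def span_diff)
    ultimately have "y \<in> V"
      by (auto simp: V_def)
    then have "norm (\<phi> t y) \<le> A * D * norm y"
      by (rule V_bound[OF t])
    also have "\<dots> \<le> A * D * (2 * real k)"
      using y norm_triangle_ineq4[of y1 y2] A(1) D by (intro mult_left_mono) (auto simp: y_def)
    finally have "norm (\<phi> t y) \<le> A * D * (2 * real k)" .
    moreover have "norm (\<phi> t x) \<le> norm (\<phi> t u) + norm (\<phi> t y)"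
      using t by (simp add: xu linear_add[OF linear_\<phi>] N'_def norm_triangle_ineq)
    ultimately show ?thesis
      using u_bound[of t] t by (simp add: L_def N'_def)
  qed
  have "norm (\<phi> t x) \<le> (2 * L / d + 1) * norm x" if t: "t \<ge> N'" and x: "x \<in> X0" for t x
  proof (cases "x = 0")
    case True
    then show ?thesis
      using t by (simp add: linear_0[OF linear_\<phi>] N'_def)
  next
    case False
    define r where "r = d / (2 * norm x)"
    have r: "r > 0"
      using d(1) False by (simp add: r_def)
    have "norm (\<phi> t (r *\<^sub>R x)) \<le> L"
    proof (rule small[OF t])
      show "r *\<^sub>R x \<in> X0"
        using x subspace_X0 by (rule subspace_scale[rotated])
      show "norm (r *\<^sub>R x) < d"
        using r False d(1) by (simp add: r_def)
    qed
    then have "r * norm (\<phi> t x) \<le> L"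
      using t r by (simp add: linear_scale[OF linear_\<phi>] N'_def)
    then have "norm (\<phi> t x) \<le> L / r"
      using r by (simp add: field_simps)
    also have "\<dots> = 2 * L / d * norm x"
      using d(1) False by (simp add: r_def)
    also have "\<dots> \<le> (2 * L / d + 1) * norm x"
      by (intro mult_right_mono) auto
    finally show ?thesis .
  qed
  moreover have "2 * L / d + 1 > 0"
    using L d(1) by (simp add: add_nonneg_pos)
  moreover have "N' \<ge> 0"
    by (simp add: N'_def)
  ultimately show ?thesis
    using that by blast
qed

lemma closed_X0: "closed X0"
proof -
  obtain M N where MN: "M > 0" "N \<ge> 0" "\<And>t x. t \<ge> N \<Longrightarrow> x \<in> X0 \<Longrightarrow> norm (\<phi> t x) \<le> M * norm x"
    using X0_equibounded by blast
  have "closed {x. ((\<lambda>t. \<phi> t x) \<longlongrightarrow> 0) at_top}"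
  proof (rule closed_tendsto_zero_set[of N \<phi> M])
    show "bounded_linear (\<phi> t)" if "t \<ge> N" for t
      using that MN(2) by (intro bounded_linear_\<phi>) simp
    show "norm (\<phi> t x) \<le> M * norm x" if "t \<ge> N" "((\<lambda>t. \<phi> t x) \<longlongrightarrow> 0) at_top" for t x
      using that by (intro MN(3)) (simp_all add: vanishing_subspace_def)
  qed (rule MN(1))
  then show ?thesis
    by (simp add: vanishing_subspace_def)
qed

text \<open>
  The distance to the closed set \<open>X\<^sub>0\<close> has a positive minimum on the compact unit sphere of the
  complement, and \<open>x\<close> differs from \<open>P x\<close> by an element of \<open>X\<^sub>0\<close>.
\<close>

lemma P_bounded:
  obtains c where "c > 0" "\<And>x. norm (P x) \<le> c * norm x"
proof -
  define S where "S = span B \<inter> sphere 0 1"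
  have S: "compact S"
    unfolding S_def by (intro compact_span_sphere fin indep)
  obtain d where d: "d > 0" "\<And>y. y \<in> S \<Longrightarrow> d \<le> infdist y X0"
  proof (cases "S = {}")
    case False
    then obtain z where z: "z \<in> S" "\<And>y. y \<in> S \<Longrightarrow> infdist z X0 \<le> infdist y X0"
      using continuous_attains_inf[OF S False continuous_on_infdist[OF continuous_on_id]] by blast
    have "z \<notin> X0"
      using z(1) X0_Int_span[of z] by (auto simp: S_def)
    then have "infdist z X0 \<noteq> 0"
      using in_closed_iff_infdist_zero[OF closed_X0] subspace_0[OF subspace_X0] by auto
    then have "infdist z X0 > 0"
      using infdist_nonneg[of z X0] by linarith
    then show ?thesis
      using z(2) that by blast
  qed (use that[of 1] in auto)
  have "norm (P x) \<le> 1 / d * norm x" for x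
  proof (cases "P x = 0")
    case False
    define r where "r = 1 / norm (P x)"
    have r: "r > 0"
      using False by (simp add: r_def)
    have "r *\<^sub>R P x \<in> S"
      using False by (simp add: S_def r_def span_scale P_in_span)
    then have "d \<le> infdist (r *\<^sub>R P x) X0"
      by (rule d(2))
    also have "\<dots> \<le> dist (r *\<^sub>R P x) ((-r) *\<^sub>R (x - P x))"
      by (intro infdist_le subspace_scale subspace_X0 diff_P_in_X0)
    also have "\<dots> = r * norm x"
      using r by (simp add: dist_norm algebra_simps)
    finally show ?thesis
      using d(1) False by (simp add: r_def field_simps)
  qed (use d in simp)
  with d(1) show ?thesis
    using that[of "1 / d"] by simp
qed

text \<open>
  This is where independence of the complement is settled: if the block is bounded on a complement
  \<open>Y'\<close> with projection \<open>P'\<close>, then \<open>P (\<phi>\<^sub>t x) = P (P' (\<phi>\<^sub>t (P' x)))\<close>, because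
  \<open>X\<^sub>0\<close> is invariant, and both projections are bounded.
\<close>

lemma quotient_block_bounded:
  assumes "slowly_increasing \<phi>"
  obtains K where "K > 0" "\<And>t x. t \<ge> 0 \<Longrightarrow> norm (P (\<phi> t x)) \<le> K * norm x"
proof -
  obtain Y' n where Y': "has_dim Y' n" "complementary X0 Y'"
    and bd: "(SUP t\<in>{0..}. onorm_on Y' (quotient_block \<phi> Y' t)) < \<infinity>"
    using assms by (auto simp: slowly_increasing_def)
  obtain B' where B': "finite B'" "independent B'" "span B' = Y'"
    using Y'(1) by (auto simp: has_dim_def)
  interpret other: complemented_semigroup \<phi> B'
    using semigroup B' Y'(2) by unfold_locales auto
  define S where "S = (SUP t\<in>{0..}. onorm_on Y' (quotient_block \<phi> Y' t))"
  define k where "k = enn2real S"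
  have k0: "k \<ge> 0"
    by (simp add: k_def)
  have Sk: "S = ennreal k"
    using bd by (simp add: S_def k_def)
  have k: "norm (other.P (\<phi> t y)) \<le> k * norm y" if t: "t \<ge> 0" and y: "y \<in> Y'" for t y
  proof (cases "y = 0")
    case True
    then show ?thesis
      using t by (simp add: linear_0[OF linear_\<phi>] linear_0[OF other.linear_P])
  next
    case False
    have "ennreal (norm (quotient_block \<phi> Y' t y) / norm y) \<le> onorm_on Y' (quotient_block \<phi> Y' t)"
      unfolding onorm_on_def using y by (rule SUP_upper)
    also have "\<dots> \<le> S"
      unfolding S_def using t by (intro SUP_upper) auto
    finally have "norm (quotient_block \<phi> Y' t y) / norm y \<le> k"
      using k0 by (simp add: Sk)
    then show ?thesis
      using False by (simp add: quotient_block_def B'(3) field_simps)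
  qed
  obtain c where c: "c > 0" "\<And>x. norm (P x) \<le> c * norm x"
    using P_bounded by blast
  obtain c' where c': "c' > 0" "\<And>x. norm (other.P x) \<le> c' * norm x"
    using other.P_bounded by blast
  have "norm (P (\<phi> t x)) \<le> (c * (k * c') + 1) * norm x" if t: "t \<ge> 0" for t x
  proof -
    have "\<phi> t x - other.P (\<phi> t (other.P x)) \<in> X0"
      using other.diff_P_in_X0[of "\<phi> t x"] other.P_\<phi>_P[OF t] by simp
    then have "norm (P (\<phi> t x)) = norm (P (other.P (\<phi> t (other.P x))))"
      by (simp only: P_cong)
    also have "\<dots> \<le> c * norm (other.P (\<phi> t (other.P x)))"
      by (rule c(2))
    also have "\<dots> \<le> c * (k * norm (other.P x))"
      using c(1) other.P_in_span B'(3) by (intro mult_left_mono k t) auto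
    also have "\<dots> \<le> c * (k * (c' * norm x))"
      using c(1) k0 by (intro mult_left_mono c') auto
    also have "\<dots> \<le> (c * (k * c') + 1) * norm x"
      by (simp add: algebra_simps)
    finally show ?thesis .
  qed
  moreover have "c * (k * c') + 1 > 0"
    using c(1) k0 c'(1) by (simp add: add_nonneg_pos)
  ultimately show ?thesis
    using that by blast
qed

end

section \<open>Slowly increasing semigroups\<close>

locale slow_semigroup = complemented_semigroup +
  fixes K :: real
  assumes cont: "\<And>v. continuous_on {0<..} (\<lambda>t. \<phi> t v)"
    and K_pos: "K > 0"
    and K: "\<And>t x. t \<ge> 0 \<Longrightarrow> norm (P (\<phi> t x)) \<le> K * norm x"
begin

lemma almost_commutes_uniformly:
  assumes "\<tau> \<ge> 0" "e > 0"
  shows "\<forall>\<^sub>F T in at_top. \<forall>s\<in>{0..\<tau>}. \<forall>y\<in>span B.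
           norm (\<phi> (T + s) y - \<phi> T (P (\<phi> s y))) \<le> e * norm y"
proof -
  obtain A where A: "A > 0" "\<And>(f :: 'a \<Rightarrow> 'a) D y. linear f \<Longrightarrow> D \<ge> 0 \<Longrightarrow>
       (\<And>b. b \<in> B \<Longrightarrow> norm (f b) \<le> D) \<Longrightarrow> y \<in> span B \<Longrightarrow> norm (f y) \<le> A * D * norm y"
    using linear_bound_on_span[OF fin indep] by metis
  obtain M N where MN: "M > 0" "N \<ge> 0" "\<And>t x. t \<ge> N \<Longrightarrow> x \<in> X0 \<Longrightarrow> norm (\<phi> t x) \<le> M * norm x"
    using X0_equibounded by blast
  \<comment> \<open>The vectors \<open>\<phi>\<^bsub>1+s\<^esub> b - \<phi>\<^sub>1 (P (\<phi>\<^sub>s b))\<close>, enclosed in a compact set without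
    any continuity of \<open>s \<mapsto> P (\<phi>\<^sub>s b)\<close>: that term is bounded in a finite-dimensional space.\<close>
  define C where "C b = {u - w | u w. u \<in> (\<lambda>s. \<phi> (1 + s) b) ` {0..\<tau>} \<and>
      w \<in> \<phi> 1 ` (span B \<inter> cball 0 (K * norm b))} \<inter> X0" for b
  have C: "compact (C b)" for b
  proof -
    have "continuous_on {0..\<tau>} (\<lambda>s. \<phi> (1 + s) b)"
      by (rule continuous_on_compose2[OF cont[of b]]) (auto intro!: continuous_intros)
    moreover have "continuous_on S (\<phi> 1)" for S
      by (intro linear_continuous_on bounded_linear_\<phi>) auto
    ultimately show ?thesis
      unfolding C_def
      by (intro compact_Int_closed[OF compact_differences] closed_X0 compact_continuous_image
          compact_span_cball fin indep) auto
  qed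
  have "\<forall>\<^sub>F T in at_top. \<forall>x\<in>C b. norm (\<phi> T x) \<le> e / A" for b
  proof (rule equibounded_tendsto_zero_uniform_on_compact[where V = X0 and M = M and N = N])
    show "linear (\<phi> t)" if "t \<ge> N" for t
      using that MN(2) by (intro linear_\<phi>) simp
    show "C b \<subseteq> X0"
      by (auto simp: C_def)
    then show "((\<lambda>t. \<phi> t x) \<longlongrightarrow> 0) at_top" if "x \<in> C b" for x
      using that by (auto intro!: X0_D)
  qed (use MN C subspace_X0 assms A(1) in auto)
  then have "\<forall>\<^sub>F T in at_top. \<forall>b\<in>B. \<forall>x\<in>C b. norm (\<phi> T x) \<le> e / A"
    using fin by (intro eventually_ball_finite) auto
  then obtain T0 where T0: "\<And>T b x. T \<ge> T0 \<Longrightarrow> b \<in> B \<Longrightarrow> x \<in> C b \<Longrightarrow> norm (\<phi> T x) \<le> e / A"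
    by (auto simp: eventually_at_top_linorder)
  show ?thesis
    using eventually_ge_at_top[of "max T0 0 + 1"]
  proof eventually_elim
    case (elim T)
    show ?case
    proof (intro ballI)
      fix s y assume s: "s \<in> {0..\<tau>}" and y: "y \<in> span B"
      define f where "f x = \<phi> (T + s) x - \<phi> T (P (\<phi> s x))" for x
      have "linear f"
        unfolding f_def using elim s
        by (intro linear_compose_sub linear_\<phi> linear_compose[OF linear_compose[OF linear_\<phi> linear_P], unfolded o_def]) auto
      moreover have "norm (f b) \<le> e / A" if b: "b \<in> B" for b
      proof -
        define x where "x = \<phi> (1 + s) b - \<phi> 1 (P (\<phi> s b))"
        have "x = \<phi> 1 (\<phi> s b - P (\<phi> s b))"
          using s by (simp add: x_def linear_diff[OF linear_\<phi>] \<phi>_compose)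
        then have "x \<in> X0"
          by (simp add: X0_invariant diff_P_in_X0)
        moreover have "P (\<phi> s b) \<in> span B \<inter> cball 0 (K * norm b)"
          using s K[of s b] by (simp add: P_in_span)
        ultimately have "x \<in> C b"
          using s unfolding C_def x_def by blast
        then have "norm (\<phi> (T - 1) x) \<le> e / A"
          using elim b by (intro T0) auto
        also have "\<phi> (T - 1) x = f b"
          using elim s by (simp add: x_def f_def linear_diff[OF linear_\<phi>] \<phi>_compose)
        finally show ?thesis .
      qed
      ultimately have "norm (f y) \<le> A * (e / A) * norm y"
        using y A(1) assms(2) by (intro A(2)) auto
      then show "norm (\<phi> (T + s) y - \<phi> T (P (\<phi> s y))) \<le> e * norm y"
        using A(1) by (simp add: f_def)
    qed
  qed
qed

text \<open>
  The part of \<open>\<phi>\<^sub>t y\<close> in \<open>X\<^sub>0\<close> need not stay bounded for general \<open>y\<close>, so decay of the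
  quotient component alone does not give decay of \<open>\<phi>\<^sub>t y\<close>. On the subspace where the quotient
  component decays, it does so uniformly, by finite dimension; choosing \<open>\<tau>\<close> with
  \<open>\<parallel>R\<^sub>\<tau>\<parallel> \<le> 1/2\<close> there makes the errors committed in each step of length \<open>\<tau>\<close> sum to
  at most twice the error of one step.
\<close>

lemma quotient_stable_imp_zero:
  assumes y: "y \<in> span B" and lim: "((\<lambda>t. P (\<phi> t y)) \<longlongrightarrow> 0) at_top"
  shows "y = 0"
proof -
  define R where "R t x = P (\<phi> t x)" for t x
  have R_lin: "linear (R t)" if "t \<ge> 0" for t
    unfolding R_def using linear_compose[OF linear_\<phi>[OF that] linear_P] by (simp add: o_def)
  have R_bl: "bounded_linear (R t)" if "t \<ge> 0" for t
    using K[OF that] by (intro bounded_linear_intro[where K = K] linear_add[OF R_lin[OF that]]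
        linear_scale[OF R_lin[OF that]]) (simp add: R_def mult.commute)
  have R_R: "R t (R s x) = R (t + s) x" if "t \<ge> 0" "s \<ge> 0" for t s x
    using that by (simp add: R_def P_\<phi>_P \<phi>_compose)
  define S where "S = {x. ((\<lambda>t. R t x) \<longlongrightarrow> 0) at_top}"
  have "closed S"
    unfolding S_def using K K_pos
    by (intro closed_tendsto_zero_set[of 0 _ K] R_bl) (auto simp: R_def)
  then have "compact (span B \<inter> cball 0 1 \<inter> S)"
    by (intro compact_Int_closed compact_span_cball fin indep)
  then have "\<forall>\<^sub>F t in at_top. \<forall>x\<in>span B \<inter> cball 0 1 \<inter> S. norm (R t x) \<le> 1/2"
    by (intro equibounded_tendsto_zero_uniform_on_compact[where V = UNIV and M = K and N = 0] R_lin)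
      (use K K_pos in \<open>auto simp: R_def S_def\<close>)
  then obtain \<tau>0 where \<tau>0:
    "\<And>t x. t \<ge> \<tau>0 \<Longrightarrow> x \<in> span B \<inter> cball 0 1 \<inter> S \<Longrightarrow> norm (R t x) \<le> 1/2"
    unfolding eventually_at_top_linorder by blast
  define \<tau> where "\<tau> = max \<tau>0 1"
  have \<tau>: "\<tau> > 0" "\<And>x. x \<in> span B \<Longrightarrow> norm x \<le> 1 \<Longrightarrow> x \<in> S \<Longrightarrow> norm (R \<tau> x) \<le> 1/2"
    by (simp add: \<tau>_def) (rule \<tau>0, simp_all add: \<tau>_def)
  have contr: "norm (R \<tau> x) \<le> norm x / 2" if x: "x \<in> span B" "x \<in> S" for x
  proof (cases "x = 0")
    case True
    then show ?thesis
      using \<tau>(1) by (simp add: linear_0[OF R_lin])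
  next
    case False
    define r where "r = 1 / norm x"
    have r: "r > 0"
      using False by (simp add: r_def)
    have "\<forall>\<^sub>F t in at_top. r *\<^sub>R R t x = R t (r *\<^sub>R x)"
      using eventually_ge_at_top[of 0] by eventually_elim (simp add: linear_scale[OF R_lin])
    moreover have "((\<lambda>t. r *\<^sub>R R t x) \<longlongrightarrow> 0) at_top"
      using x(2) tendsto_scaleR[OF tendsto_const, of "\<lambda>t. R t x" 0 at_top r] by (simp add: S_def)
    ultimately have "r *\<^sub>R x \<in> S"
      unfolding S_def using Lim_transform_eventually by fastforce
    then have "norm (R \<tau> (r *\<^sub>R x)) \<le> 1/2"
      using False by (intro \<tau>(2) span_scale x) (auto simp: r_def)
    then show ?thesis
      using r \<tau>(1) False by (simp add: linear_scale[OF R_lin] r_def field_simps)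
  qed
  have R_S: "R s x \<in> S" if x: "x \<in> S" and s: "s \<ge> 0" for x s
  proof -
    have "((\<lambda>t. R s (R t x)) \<longlongrightarrow> 0) at_top"
      using x by (intro bounded_linear.tendsto_zero[OF R_bl[OF s]]) (simp add: S_def)
    moreover have "\<forall>\<^sub>F t in at_top. R s (R t x) = R t (R s x)"
      using eventually_ge_at_top[of 0] by eventually_elim (simp add: R_R s add.commute)
    ultimately show ?thesis
      unfolding S_def mem_Collect_eq by (rule Lim_transform_eventually)
  qed
  have R_span: "R s x \<in> span B" for s x
    by (simp add: R_def P_in_span)
  have yS: "y \<in> S"
    using lim by (simp add: S_def R_def)

  have "\<forall>\<^sub>F T in at_top. dist (\<phi> T y) 0 < e" if "e > 0" for e
  proof -
    \<comment> \<open>Chosen so that the final bound \<open>(3 K + 1) d \<parallel>y\<parallel>\<close> falls below \<open>e\<close>.\<close>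
    define d where "d = e / ((3 * K + 1) * (norm y + 1))"
    have d: "d > 0"
      using \<open>e > 0\<close> K_pos by (simp add: d_def add_nonneg_pos)
    have "\<forall>\<^sub>F T in at_top. \<forall>s\<in>{0..\<tau>}. \<forall>x\<in>span B. norm (\<phi> (T + s) x - \<phi> T (R s x)) \<le> d * norm x"
      unfolding R_def using almost_commutes_uniformly[of \<tau> d] \<tau>(1) d by simp
    then have "\<exists>T0. \<forall>T\<ge>T0. \<forall>s\<in>{0..\<tau>}. \<forall>x\<in>span B. norm (\<phi> (T + s) x - \<phi> T (R s x)) \<le> d * norm x"
      by (simp add: eventually_at_top_linorder)
    then obtain T1 where T1: "\<And>T s x. T \<ge> T1 \<Longrightarrow> s \<in> {0..\<tau>} \<Longrightarrow> x \<in> span B \<Longrightarrow>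
        norm (\<phi> (T + s) x - \<phi> T (R s x)) \<le> d * norm x"
      by blast
    define T0 where "T0 = max T1 0"
    have T0: "T0 \<ge> 0"
      by (simp add: T0_def)
    have step: "norm (\<phi> (T + s) x) \<le> norm (\<phi> T (R s x)) + d * norm x"
      if "T \<ge> T0" "s \<in> {0..\<tau>}" "x \<in> span B" for T s x
    proof -
      have "T \<ge> T1"
        using that(1) by (simp add: T0_def)
      then show ?thesis
        using T1[of T s x] that norm_triangle_sub[of "\<phi> (T + s) x" "\<phi> T (R s x)"] by linarith
    qed
    define a where "a = onorm (\<phi> T0)"
    have a: "norm (\<phi> T0 x) \<le> a * norm x" for x
      unfolding a_def by (rule onorm[OF bounded_linear_\<phi>[OF T0]])
    have a0: "a \<ge> 0"
      unfolding a_def by (rule onorm_pos_le[OF bounded_linear_\<phi>[OF T0]])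
    \<comment> \<open>The term \<open>2 d\<close> is the fixed point of the recursion \<open>m \<mapsto> m / 2 + d\<close>.\<close>
    have geo: "norm (\<phi> (T0 + real k * \<tau>) x) \<le> ((1/2)^k * a + 2 * d) * norm x"
      if "x \<in> span B" "x \<in> S" for k x
      using that
    proof (induction k arbitrary: x)
      case 0
      then show ?case
        using a[of x] d by (simp add: algebra_simps add_increasing2)
    next
      case (Suc k)
      have "norm (\<phi> (T0 + real (Suc k) * \<tau>) x) = norm (\<phi> (T0 + real k * \<tau> + \<tau>) x)"
        by (simp add: algebra_simps)
      also have "\<dots> \<le> norm (\<phi> (T0 + real k * \<tau>) (R \<tau> x)) + d * norm x"
        using \<tau>(1) Suc.prems by (intro step) auto
      also have "norm (\<phi> (T0 + real k * \<tau>) (R \<tau> x)) \<le> ((1/2)^k * a + 2 * d) * norm (R \<tau> x)"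
        using \<tau>(1) Suc.prems by (intro Suc.IH R_span R_S) auto
      also have "\<dots> \<le> ((1/2)^k * a + 2 * d) * (norm x / 2)"
        using a0 d Suc.prems by (intro mult_left_mono contr) auto
      also have "\<dots> + d * norm x = ((1/2)^Suc k * a + 2 * d) * norm x"
        by (simp add: algebra_simps)
      finally show ?case
        by simp
    qed
    have "(\<lambda>k. (1/2)^k * a) \<longlonglongrightarrow> 0"
      by (intro tendsto_mult_left_zero LIMSEQ_power_zero) auto
    then have "\<forall>\<^sub>F k in sequentially. (1/2)^k * a < d"
      using d by (rule order_tendstoD)
    then obtain k0 where k0: "\<And>k. k \<ge> k0 \<Longrightarrow> (1/2)^k * a < d"
      by (auto simp: eventually_sequentially)
    have "norm (\<phi> T y) < e" if T: "T \<ge> T0 + real k0 * \<tau>" for T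
    proof -
      \<comment> \<open>\<open>T = T0 + k \<tau> + s\<close> with \<open>0 \<le> s \<le> \<tau>\<close>.\<close>
      define k where "k = nat \<lfloor>(T - T0) / \<tau>\<rfloor>"
      define s where "s = T - T0 - real k * \<tau>"
      have q: "real k0 \<le> (T - T0) / \<tau>"
        using T \<tau>(1) by (simp add: field_simps)
      then have "k0 \<le> k"
        by (simp add: k_def le_nat_floor)
      have q0: "(T - T0) / \<tau> \<ge> 0"
        using q by (rule order_trans[rotated]) simp
      have "real k \<le> (T - T0) / \<tau>" "(T - T0) / \<tau> \<le> real k + 1"
        using q0 by (simp_all add: k_def)
      then have s: "s \<in> {0..\<tau>}"
        using \<tau>(1) by (simp add: s_def field_simps)
      have "norm (\<phi> T y) = norm (\<phi> (T0 + real k * \<tau> + s) y)"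
        by (simp add: s_def)
      also have "\<dots> \<le> norm (\<phi> (T0 + real k * \<tau>) (R s y)) + d * norm y"
        using \<tau>(1) s y by (intro step) auto
      also have "norm (\<phi> (T0 + real k * \<tau>) (R s y)) \<le> ((1/2)^k * a + 2 * d) * norm (R s y)"
        using s yS by (intro geo R_span R_S) auto
      also have "\<dots> \<le> (3 * d) * norm (R s y)"
        using k0[OF \<open>k0 \<le> k\<close>] by (intro mult_right_mono) auto
      also have "\<dots> \<le> (3 * d) * (K * norm y)"
        using s d K[of s y] by (intro mult_left_mono) (auto simp: R_def)
      also have "3 * d * (K * norm y) + d * norm y = d * (3 * K + 1) * norm y"
        by (simp add: algebra_simps)
      also have "\<dots> < d * (3 * K + 1) * (norm y + 1)"
        using d K_pos by (intro mult_strict_left_mono) auto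
      also have "\<dots> = e"
      proof -
        have "3 * K + 1 \<noteq> 0" "norm y + 1 \<noteq> 0"
          using K_pos norm_ge_zero[of y] by linarith+
        then show ?thesis
          by (simp add: d_def)
      qed
      finally show ?thesis
        by simp
    qed
    then show ?thesis
      by (auto simp: eventually_at_top_linorder)
  qed
  then have "y \<in> X0"
    unfolding vanishing_subspace_def by (intro CollectI tendstoI)
  then show ?thesis
    using y X0_Int_span by blast
qed

text \<open>
  If \<open>R\<^sub>t\<close> is small at a unit vector of the complement for some \<open>t\<close>, boundedness keeps it small
  at all later times; a limit of such vectors would decay.
\<close>

lemma quotient_bounded_below:
  obtains c where "c > 0" "\<And>t y. t \<ge> 0 \<Longrightarrow> y \<in> span B \<Longrightarrow> c * norm y \<le> norm (P (\<phi> t y))"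
proof (rule ccontr)
  note below = that
  assume "\<not> thesis"
  then have ex: "\<exists>t y. t \<ge> 0 \<and> y \<in> span B \<and> norm (P (\<phi> t y)) < c * norm y" if c: "c > 0" for c
    using \<open>\<not> thesis\<close> below[OF c] not_le by blast
  have R_lin: "linear (\<lambda>x. P (\<phi> t x))" if "t \<ge> 0" for t
    using linear_compose[OF linear_\<phi>[OF that] linear_P] by (simp add: o_def)
  define S where "S = span B \<inter> sphere 0 1"
  have S: "compact S"
    unfolding S_def by (intro compact_span_sphere fin indep)
  have "\<exists>t y. t \<ge> 0 \<and> y \<in> S \<and> norm (P (\<phi> t y)) < 1 / real (Suc n)" for n
  proof -
    obtain t y where ty: "t \<ge> 0" "y \<in> span B" "norm (P (\<phi> t y)) < 1 / real (Suc n) * norm y"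
      using ex[of "1 / real (Suc n)"] by auto
    have y0: "norm y > 0"
      using ty(3) by (cases "y = 0") (auto simp: linear_0[OF R_lin[OF ty(1)]])
    have "norm (P (\<phi> t ((1 / norm y) *\<^sub>R y))) = norm (P (\<phi> t y)) / norm y"
      using y0 by (simp add: linear_scale[OF R_lin[OF ty(1)]])
    also have "\<dots> < 1 / real (Suc n)"
      using ty(3) y0 by (simp add: pos_divide_less_eq)
    finally have "norm (P (\<phi> t ((1 / norm y) *\<^sub>R y))) < 1 / real (Suc n)" .
    moreover have "(1 / norm y) *\<^sub>R y \<in> S"
      using y0 ty(2) by (simp add: S_def span_scale)
    ultimately show ?thesis
      using ty(1) by blast
  qed
  then obtain t y where t: "\<And>n. t n \<ge> 0" and y: "\<And>n. y n \<in> S"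
    and ty: "\<And>n. norm (P (\<phi> (t n) (y n))) < 1 / real (Suc n)"
    by metis
  obtain z r where z: "z \<in> S" and r: "strict_mono r" and lim: "(y \<circ> r) \<longlonglongrightarrow> z"
    using S y unfolding compact_def by blast
  have "\<forall>\<^sub>F T in at_top. dist (P (\<phi> T z)) 0 < e" if e: "e > 0" for e
  proof -
    have "(\<lambda>n. K * (1 / real (Suc (r n)) + K * norm (z - y (r n)))) \<longlonglongrightarrow> K * (0 + K * norm (z - z))"
      using lim LIMSEQ_subseq_LIMSEQ[OF LIMSEQ_inverse_real_of_nat r]
      by (intro tendsto_intros) (simp_all add: o_def inverse_eq_divide)
    then have "\<forall>\<^sub>F n in sequentially. K * (1 / real (Suc (r n)) + K * norm (z - y (r n))) < e"
      using e by (intro order_tendstoD(2)) auto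
    then obtain n where n: "K * (1 / real (Suc (r n)) + K * norm (z - y (r n))) < e"
      by (auto simp: eventually_sequentially)
    have "dist (P (\<phi> T z)) 0 < e" if T: "T \<ge> t (r n)" for T
    proof -
      have "norm (P (\<phi> T z)) = norm (P (\<phi> (T - t (r n)) (P (\<phi> (t (r n)) z))))"
        using T t[of "r n"] by (simp add: P_\<phi>_P \<phi>_compose)
      also have "\<dots> \<le> K * norm (P (\<phi> (t (r n)) z))"
        using T by (intro K) simp
      also have "P (\<phi> (t (r n)) z) = P (\<phi> (t (r n)) (y (r n))) + P (\<phi> (t (r n)) (z - y (r n)))"
        by (simp add: linear_diff[OF R_lin[OF t]])
      also have "K * norm \<dots> \<le> K * (1 / real (Suc (r n)) + K * norm (z - y (r n)))"
        using K_pos ty[of "r n"] K[OF t[of "r n"], of "z - y (r n)"]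
        by (intro mult_left_mono norm_triangle_mono) auto
      finally show ?thesis
        using n by simp
    qed
    then show ?thesis
      by (auto simp: eventually_at_top_linorder)
  qed
  then have "((\<lambda>T. P (\<phi> T z)) \<longlongrightarrow> 0) at_top"
    by (rule tendstoI)
  then have "z = 0"
    using z by (intro quotient_stable_imp_zero) (auto simp: S_def)
  then show False
    using z by (simp add: S_def)
qed

text \<open>
  The witness for the distance from \<open>\<phi>\<^bsub>T+s\<^esub> y\<close> to \<open>Y\<^sub>T\<close> is \<open>\<phi>\<^sub>T (Q\<^sub>s y)\<close>. The opposite
  comparison would require solving \<open>Q\<^sub>s y' = y\<close>, but the minimum in the angle makes one direction
  enough.
\<close>

lemma span_almost_stabilizable: "almost_stabilizable \<phi> (span B)"
proof -
  obtain c where c: "c > 0" "\<And>t y. t \<ge> 0 \<Longrightarrow> y \<in> span B \<Longrightarrow> c * norm y \<le> norm (P (\<phi> t y))"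
    using quotient_bounded_below by blast
  obtain p where p: "p > 0" "\<And>x. norm (P x) \<le> p * norm x"
    using P_bounded by blast
  have lower: "norm y \<le> p / c * norm (\<phi> t y)" if "t \<ge> 0" "y \<in> span B" for t y
    using c(2)[OF that] p(2)[of "\<phi> t y"] c(1) by (simp add: field_simps)
  have "\<forall>\<^sub>F T in at_top. (SUP s\<in>{0..<t}. subspace_angle (\<phi> T ` span B) (\<phi> (T + s) ` span B)) < e"
    if "e > 0" for t :: real and e :: ennreal
  proof -
    obtain d' where d': "0 < d'" "d' < e"
      using dense[OF \<open>e > 0\<close>] by blast
    define d where "d = enn2real d'"
    have "ennreal d = d'"
      unfolding d_def using d'(2) by (intro ennreal_enn2real) (auto intro: less_le_trans)
    then have d: "d > 0" "ennreal d < e"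
      using d' by auto
    define \<epsilon> where "\<epsilon> = d * c / p"
    have \<epsilon>: "\<epsilon> > 0"
      using d(1) c(1) p(1) by (simp add: \<epsilon>_def)
    show ?thesis
      using almost_commutes_uniformly[of "max t 0" \<epsilon>, OF _ \<epsilon>, simplified] eventually_ge_at_top[of 0]
    proof eventually_elim
      case (elim T)
      have "subspace_angle (\<phi> T ` span B) (\<phi> (T + s) ` span B) \<le> ennreal d" if s: "s \<in> {0..<t}" for s
      proof -
        have "infdist v (\<phi> T ` span B) \<le> d" if v: "v \<in> \<phi> (T + s) ` span B" "norm v = 1" for v
        proof -
          obtain y where y: "y \<in> span B" "v = \<phi> (T + s) y"
            using v(1) by blast
          have "infdist v (\<phi> T ` span B) \<le> dist v (\<phi> T (P (\<phi> s y)))"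
            by (intro infdist_le imageI P_in_span)
          also have "\<dots> \<le> \<epsilon> * norm y"
            using elim(1) s y by (auto simp: dist_norm)
          also have "\<dots> \<le> \<epsilon> * (p / c * norm v)"
            using \<epsilon> lower[of "T + s" y] elim(2) s y by (intro mult_left_mono) simp_all
          also have "\<dots> = d"
            using v(2) c(1) p(1) by (simp add: \<epsilon>_def)
          finally show ?thesis .
        qed
        then have "(SUP b\<in>{b \<in> \<phi> (T + s) ` span B. norm b = 1}. ennreal (infdist b (\<phi> T ` span B))) \<le> ennreal d"
          using d(1) by (intro SUP_least ennreal_leI) auto
        then show ?thesis
          unfolding subspace_angle_def by (rule min.coboundedI2)
      qed
      then have "(SUP s\<in>{0..<t}. subspace_angle (\<phi> T ` span B) (\<phi> (T + s) ` span B)) \<le> ennreal d"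
        by (rule SUP_least)
      then show ?case
        using d(2) by (rule le_less_trans)
    qed
  qed
  then show ?thesis
    unfolding almost_stabilizable_def by (intro allI order_tendstoI) auto
qed

end

theorem mainTheorem4:
  fixes \<phi> :: "real \<Rightarrow> 'a::banach \<Rightarrow> 'a" and n :: nat and Y :: "'a set"
  assumes "operator_semigroup \<phi>"
    and "\<And>v. continuous_on {0<..} (\<lambda>t. \<phi> t v)"
    and "has_codim (vanishing_subspace \<phi>) n"
    and "slowly_increasing \<phi>"
    and "has_dim Y n"
    and "complementary (vanishing_subspace \<phi>) Y"
  shows "almost_stabilizable \<phi> Y"
proof -
  obtain B where B: "finite B" "independent B" "span B = Y"
    using assms(5) by (auto simp: has_dim_def)
  interpret complemented_semigroup \<phi> B
    using assms(1,6) B by unfold_locales auto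
  obtain K where K: "K > 0" "\<And>t x. t \<ge> 0 \<Longrightarrow> norm (P (\<phi> t x)) \<le> K * norm x"
    using quotient_block_bounded[OF assms(4)] by blast
  interpret slow_semigroup \<phi> B K
    using assms(2) K by unfold_locales auto
  show ?thesis
    using span_almost_stabilizable B(3) by simp
qed

end
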